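(* Let $\mathbf M$ be a balanced residuated partially ordered semigroup and let $S=\operatorname{Sk}(\mathbf M)$ be its positive-idempotent skeleton. Then the residual coherentization $\mathcal C_{\mathrm r}(\mathbf M)$ is the finest $\tau$-residuation-coherent skeleton partition of $S$; that is, $\mathcal C_{\mathrm r}(\mathbf M)$ is $\tau$-residuation-coherent, and every $\tau$-residuation-coherent skeleton partition $\Phi$ of $S$ satisfies $\mathcal C_{\mathrm r}(\mathbf M)\le\Phi$. Moreover, the block set $\mathcal C_{\mathrm r}(\mathbf M)$ is a join-semilattice under the (well-defined) operation $A\vee B:=[u\vee v]$ for $u\in A$, $v\in B$, where $[\,\cdot\,]$ denotes the block of an element, and $\mathcal C_{\mathrm r}(\mathbf M)$ is also $\tau$-multiplication-coherent.
   Context: A residuated partially ordered semigroup is a structure $\mathbf M=\langle M,\le,\cdot,\backslash,/\rangle$ with $\langle M,\le\rangle$ a poset, $\langle M,\cdot\rangle$ a semigroup, and $xy\le z\iff x\le z/y\iff y\le x\backslash z$. An element $p\in M$ is positive if $z\le zp$ and $z\le pz$ for all $z\in M$. $\mathbf M$ is balanced if for every $x\in M$ one has $x\backslash x=x/x$ and this common value is positive; it is then automatically idempotent. Put $\tau(x):=x\backslash x=x/x$. The positive-idempotent skeleton $\operatorname{Sk}(\mathbf M)$ is the set of positive idempotents ($u^2=u$, $u$ positive) with the order inherited from $\mathbf M$; it is a join-semilattice in which $u\vee v=uv=vu$. For $A\subseteq S=\operatorname{Sk}(\mathbf M)$ put $L_A:=\{x\in M:\tau(x)\in A\}$. A skeleton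 partition is a partition of $S$. Refinement order: $\Theta\le\Phi$ iff every block of $\Theta$ is contained in a block of $\Phi$ (smaller = finer). For $A,B\subseteq S$ put $A\star_\tau B:=\{\tau(xy),\tau(x\backslash y),\tau(x/y): x\in L_A,\ y\in L_B\}$. For a skeleton partition $\Theta$ and $A,B\in\Theta$ put $\operatorname{Out}_\Theta(A,B):=\{C\in\Theta: C\cap(A\star_\tau B)\neq\varnothing\}$. $\Theta$ is $\tau$-residuation-coherent if $\operatorname{Out}_\Theta(A,B)$ is a singleton for all $A,B\in\Theta$. $\Theta$ is $\tau$-multiplication-coherent if for all $A,B\in\Theta$ the set $\{\tau(xy):x\in L_A,\ y\in L_B\}$ is contained in a single $\Theta$-block. Residual connected-component coarsening: for a skeleton partition $\Theta$, form the graph on the blocks of $\Theta$ joining distinct blocks $C,D$ whenever there are $A,B\in\Theta$ with $C,D\in\operatorname{Out}_\Theta(A,B)$; $\operatorname{CC}_{\mathrm r}(\Theta)$ is the partition obtained by merging precisely the blocks lying in the same connected component of this graph. Residual coherentization: let $\Theta_0=\{\{u\}:u\in S\}$, $\Theta_{n+1}=\operatorname{CC}_{\mathrm r}(\Theta_n)$ for $n<\omega$, let $\equiv_n$ be the equivalence relation of $\Theta_n$ (an increasing sequence), and let $\mathcal C_{\mathrm r}(\mathbf M)$ be the partition of $S$ into the classes of the equivalence relation $\bigcup_{n<\omega}\equiv_n$. *)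

theory Defs
  imports "HOL-Algebra.Lattice" "HOL-Library.Disjoint_Sets"
begin

section \<open>Balanced residuated partially ordered semigroups\<close>

record 'a residuated_struct = "'a gorder" +
  mul :: "'a \<Rightarrow> 'a \<Rightarrow> 'a"  (infixl \<open>\<cdot>\<index>\<close> 70)
  lres :: "'a \<Rightarrow> 'a \<Rightarrow> 'a" (infix \<open>\<setminus>\<index>\<close> 70)
  rres :: "'a \<Rightarrow> 'a \<Rightarrow> 'a" (infix \<open>\<sslash>\<index>\<close> 70)

locale residuated_posemigroup = partial_order M
  for M :: "('a, 'm) residuated_struct_scheme" (structure) +
  assumes mul_closed: "x \<in> carrier M \<Longrightarrow> y \<in> carrier M \<Longrightarrow> x \<cdot> y \<in> carrier M"
    and lres_closed: "x \<in> carrier M \<Longrightarrow> y \<in> carrier M \<Longrightarrow> x \<setminus> y \<in> carrier M"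
    and rres_closed: "x \<in> carrier M \<Longrightarrow> y \<in> carrier M \<Longrightarrow> x \<sslash> y \<in> carrier M"
    and mul_assoc: "x \<in> carrier M \<Longrightarrow> y \<in> carrier M \<Longrightarrow> z \<in> carrier M
      \<Longrightarrow> (x \<cdot> y) \<cdot> z = x \<cdot> (y \<cdot> z)"
    and residuation_right: "x \<in> carrier M \<Longrightarrow> y \<in> carrier M \<Longrightarrow> z \<in> carrier M
      \<Longrightarrow> x \<cdot> y \<sqsubseteq> z \<longleftrightarrow> x \<sqsubseteq> z \<sslash> y"
    and residuation_left: "x \<in> carrier M \<Longrightarrow> y \<in> carrier M \<Longrightarrow> z \<in> carrier M
      \<Longrightarrow> x \<cdot> y \<sqsubseteq> z \<longleftrightarrow> y \<sqsubseteq> x \<setminus> z"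

definition positive :: "('a, 'm) residuated_struct_scheme \<Rightarrow> 'a \<Rightarrow> bool" where
  "positive M p \<longleftrightarrow> p \<in> carrier M \<and>
     (\<forall>z \<in> carrier M. z \<sqsubseteq>\<^bsub>M\<^esub> z \<cdot>\<^bsub>M\<^esub> p \<and> z \<sqsubseteq>\<^bsub>M\<^esub> p \<cdot>\<^bsub>M\<^esub> z)"

locale balanced_residuated_posemigroup = residuated_posemigroup M
  for M :: "('a, 'm) residuated_struct_scheme" (structure) +
  assumes balanced_eq: "x \<in> carrier M \<Longrightarrow> x \<setminus> x = x \<sslash> x"
    and balanced_positive: "x \<in> carrier M \<Longrightarrow> positive M (x \<setminus> x)"

definition tau :: "('a, 'm) residuated_struct_scheme \<Rightarrow> 'a \<Rightarrow> 'a" where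
  "tau M x = x \<setminus>\<^bsub>M\<^esub> x"

definition Sk :: "('a, 'm) residuated_struct_scheme \<Rightarrow> 'a set" where
  "Sk M = {u. positive M u \<and> u \<cdot>\<^bsub>M\<^esub> u = u}"

text \<open>The skeleton as a poset; joins of skeleton elements are least upper bounds
  taken in this poset, not in \<open>M\<close>.\<close>

definition Sk_poset :: "('a, 'm) residuated_struct_scheme \<Rightarrow> 'a gorder" where
  "Sk_poset M = \<lparr>carrier = Sk M, eq = (=), le = (\<sqsubseteq>\<^bsub>M\<^esub>)\<rparr>"

definition layer :: "('a, 'm) residuated_struct_scheme \<Rightarrow> 'a set \<Rightarrow> 'a set" where
  "layer M A = {x \<in> carrier M. tau M x \<in> A}"

section \<open>Coherent skeleton partitions\<close>

text \<open>Skeleton partitions are the \<open>\<Theta>\<close> with \<^term>\<open>partition_on (Sk M) \<Theta>\<close>,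
  and the refinement order is \<^term>\<open>refines (Sk M)\<close>, the finer partition first.\<close>

definition tau_star ::
    "('a, 'm) residuated_struct_scheme \<Rightarrow> 'a set \<Rightarrow> 'a set \<Rightarrow> 'a set" where
  "tau_star M A B = (\<Union>x \<in> layer M A. \<Union>y \<in> layer M B.
     {tau M (x \<cdot>\<^bsub>M\<^esub> y), tau M (x \<setminus>\<^bsub>M\<^esub> y), tau M (x \<sslash>\<^bsub>M\<^esub> y)})"

definition Out ::
    "('a, 'm) residuated_struct_scheme \<Rightarrow> 'a set set \<Rightarrow> 'a set \<Rightarrow> 'a set \<Rightarrow> 'a set set" where
  "Out M \<Theta> A B = {C \<in> \<Theta>. C \<inter> tau_star M A B \<noteq> {}}"

definition tau_residuation_coherent ::
    "('a, 'm) residuated_struct_scheme \<Rightarrow> 'a set set \<Rightarrow> bool" where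
  "tau_residuation_coherent M \<Theta> \<longleftrightarrow> (\<forall>A \<in> \<Theta>. \<forall>B \<in> \<Theta>. is_singleton (Out M \<Theta> A B))"

definition tau_multiplication_coherent ::
    "('a, 'm) residuated_struct_scheme \<Rightarrow> 'a set set \<Rightarrow> bool" where
  "tau_multiplication_coherent M \<Theta> \<longleftrightarrow> (\<forall>A \<in> \<Theta>. \<forall>B \<in> \<Theta>. \<exists>C \<in> \<Theta>.
     {tau M (x \<cdot>\<^bsub>M\<^esub> y) | x y. x \<in> layer M A \<and> y \<in> layer M B} \<subseteq> C)"

section \<open>Residual coherentization\<close>

definition out_edges ::
    "('a, 'm) residuated_struct_scheme \<Rightarrow> 'a set set \<Rightarrow> ('a set \<times> 'a set) set" where
  "out_edges M \<Theta> = {(C, D). C \<noteq> D \<and> (\<exists>A \<in> \<Theta>. \<exists>B \<in> \<Theta>. C \<in> Out M \<Theta> A B \<and> D \<in> Out M \<Theta> A B)}"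

text \<open>The edge relation is symmetric, so its reflexive transitive closure relates
  precisely the blocks in the same connected component.\<close>

definition CC_r :: "('a, 'm) residuated_struct_scheme \<Rightarrow> 'a set set \<Rightarrow> 'a set set" where
  "CC_r M \<Theta> = {\<Union> ((out_edges M \<Theta>)\<^sup>* `` {C}) | C. C \<in> \<Theta>}"

fun coherentization_step ::
    "('a, 'm) residuated_struct_scheme \<Rightarrow> nat \<Rightarrow> 'a set set" where
  "coherentization_step M 0 = {{u} | u. u \<in> Sk M}"
| "coherentization_step M (Suc n) = CC_r M (coherentization_step M n)"

definition partition_rel :: "'a set set \<Rightarrow> ('a \<times> 'a) set" where
  "partition_rel \<Theta> = {(u, v). \<exists>A \<in> \<Theta>. u \<in> A \<and> v \<in> A}"

definition residual_coherentization ::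
    "('a, 'm) residuated_struct_scheme \<Rightarrow> 'a set set" where
  "residual_coherentization M = Sk M // (\<Union>n. partition_rel (coherentization_step M n))"

section \<open>The join operation on blocks\<close>

definition block :: "'a set set \<Rightarrow> 'a \<Rightarrow> 'a set" where
  "block \<Theta> u = (THE A. A \<in> \<Theta> \<and> u \<in> A)"

text \<open>Only meaningful if the block of \<open>u \<squnion> v\<close> does not depend on the representatives.\<close>

definition block_join ::
    "('a, 'm) residuated_struct_scheme \<Rightarrow> 'a set set \<Rightarrow> 'a set \<Rightarrow> 'a set \<Rightarrow> 'a set" where
  "block_join M \<Theta> A B =
     (THE C. \<exists>u \<in> A. \<exists>v \<in> B. C = block \<Theta> (u \<squnion>\<^bsub>Sk_poset M\<^esub> v))"

text \<open>The order on blocks induced by the join operation: \<open>A \<le> B\<close> iff \<open>A \<squnion> B = B\<close>.\<close>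

definition block_poset ::
    "('a, 'm) residuated_struct_scheme \<Rightarrow> 'a set set \<Rightarrow> 'a set gorder" where
  "block_poset M \<Theta> =
     \<lparr>carrier = \<Theta>, eq = (=), le = (\<lambda>A B. block_join M \<Theta> A B = B)\<rparr>"

end

theory Submission
  imports Defs
begin

text \<open>In a balanced residuated posemigroup \<open>\<tau>\<close> retracts the carrier onto the skeleton, and
  skeleton joins are products, so \<open>\<tau>(uv) = u \<squnion> v\<close> there. Hence every output set is nonempty, and
  a partition is \<open>\<tau>\<close>-residuation-coherent iff all outputs of two given blocks lie in one block.
  For the coherentization this holds because finitely many identifications in the limit already
  occur at a finite stage, whose outputs are merged at the next stage. Each stage only merges
  blocks that any coherent partition must put together, which gives minimality. The join on blocks
  inherits the semilattice laws from representatives.\<close>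

section \<open>Partitions and semilattices\<close>

lemma partition_on_block_unique:
  assumes "partition_on S \<Theta>" "A \<in> \<Theta>" "B \<in> \<Theta>" "u \<in> A" "u \<in> B"
  shows "A = B"
  using assms by (auto simp: partition_on_def disjoint_def)

lemma partition_on_block_exists:
  assumes "partition_on S \<Theta>" "u \<in> S"
  obtains A where "A \<in> \<Theta>" "u \<in> A"
  using assms by (auto simp: partition_on_def)

lemma block_eq:
  assumes "partition_on S \<Theta>" "A \<in> \<Theta>" "u \<in> A"
  shows "block \<Theta> u = A"
  unfolding block_def
proof (rule the_equality)
  show "B = A" if "B \<in> \<Theta> \<and> u \<in> B" for B
    using partition_on_block_unique[OF assms(1)] assms(2,3) that by blast
qed (use assms in simp)

text \<open>Symmetry makes the reachability relation \<open>R\<^sup>*\<close> an equivalence on the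
  blocks, so components are either equal or share no block. Disjointness of \<open>P\<close> carries
  this over to their unions.\<close>

lemma partition_on_merge:
  assumes P: "partition_on S P" and R: "sym R" "R \<subseteq> P \<times> P"
  shows "partition_on S {\<Union> (R\<^sup>* `` {C}) | C. C \<in> P}"
proof -
  have closed: "R\<^sup>* `` {C} \<subseteq> P" if "C \<in> P" for C
  proof
    fix D assume "D \<in> R\<^sup>* `` {C}"
    then have "(C, D) \<in> R\<^sup>*" by simp
    then show "D \<in> P" by (induction rule: rtrancl_induct) (use that R in auto)
  qed
  have sym: "sym (R\<^sup>*)" using R by (simp add: sym_rtrancl)
  show ?thesis
  proof (rule partition_onI)
    show "\<Union> {\<Union> (R\<^sup>* `` {C}) | C. C \<in> P} = S"
    proof
      show "\<Union> {\<Union> (R\<^sup>* `` {C}) | C. C \<in> P} \<subseteq> S"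
        using closed partition_onD1[OF P] by blast
      show "S \<subseteq> \<Union> {\<Union> (R\<^sup>* `` {C}) | C. C \<in> P}"
      proof
        fix x assume "x \<in> S"
        then obtain C where "C \<in> P" "x \<in> C" using partition_onD1[OF P] by blast
        then show "x \<in> \<Union> {\<Union> (R\<^sup>* `` {C}) | C. C \<in> P}" by blast
      qed
    qed
    show "{} \<notin> {\<Union> (R\<^sup>* `` {C}) | C. C \<in> P}"
    proof
      assume "{} \<in> {\<Union> (R\<^sup>* `` {C}) | C. C \<in> P}"
      then obtain C where "C \<in> P" "\<Union> (R\<^sup>* `` {C}) = {}" by auto
      then have "C = {}" by blast
      with \<open>C \<in> P\<close> show False using partition_onD3[OF P] by simp
    qed
  next
    fix p q assume "p \<in> {\<Union> (R\<^sup>* `` {C}) | C. C \<in> P}" "q \<in> {\<Union> (R\<^sup>* `` {C}) | C. C \<in> P}"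
      and ne: "p \<noteq> q"
    then obtain C D where C: "C \<in> P" "p = \<Union> (R\<^sup>* `` {C})" and D: "D \<in> P" "q = \<Union> (R\<^sup>* `` {D})"
      by blast
    show "disjnt p q"
    proof (rule ccontr)
      assume "\<not> disjnt p q"
      then obtain x C' D' where x: "x \<in> C'" "x \<in> D'" "(C, C') \<in> R\<^sup>*" "(D, D') \<in> R\<^sup>*"
        using C D by (auto simp: disjnt_iff)
      \<comment> \<open>The common point forces both paths to end in one block. Walking one of them
        back connects \<open>C\<close> with \<open>D\<close>.\<close>
      then have "C' = D'"
        using closed C D by (intro partition_on_block_unique[OF P, of _ _ x]) auto
      then have "(C, D) \<in> R\<^sup>*" "(D, C) \<in> R\<^sup>*"
        using x sym by (meson rtrancl_trans symD)+
      then have "R\<^sup>* `` {C} = R\<^sup>* `` {D}" by (auto intro: rtrancl_trans)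
      with C D ne show False by simp
    qed
  qed
qed

lemma equiv_partition_rel:
  assumes "partition_on S \<Theta>"
  shows "equiv S (partition_rel \<Theta>)"
  using equiv_partition_on[OF assms] unfolding partition_rel_def by (simp add: Bex_def)

text \<open>Only transitivity mixes two indices. Along an increasing chain both pairs are already
  present at the larger one.\<close>

lemma equiv_UN_mono:
  fixes r :: "nat \<Rightarrow> ('a \<times> 'a) set"
  assumes "\<And>n. equiv S (r n)" "mono r"
  shows "equiv S (\<Union>n. r n)"
proof (rule equivI)
  show "(\<Union>n. r n) \<subseteq> S \<times> S" using assms(1) by (auto simp: equiv_def refl_on_def)
  show "refl_on S (\<Union>n. r n)" using assms(1) by (auto simp: equiv_def refl_on_def)
  show "sym (\<Union>n. r n)" using assms(1) by (auto simp: equiv_def sym_def)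
  show "trans (\<Union>n. r n)"
  proof (rule transI)
    fix x y z assume "(x, y) \<in> (\<Union>n. r n)" "(y, z) \<in> (\<Union>n. r n)"
    then obtain i j where "(x, y) \<in> r i" "(y, z) \<in> r j" by blast
    then have "(x, y) \<in> r (max i j)" "(y, z) \<in> r (max i j)"
      using monoD[OF assms(2)] by (meson max.cobounded1 max.cobounded2 subsetD)+
    then have "(x, z) \<in> r (max i j)" using assms(1) by (meson equivE transD)
    then show "(x, z) \<in> (\<Union>n. r n)" by blast
  qed
qed

text \<open>The join is a \<open>SOME\<close> choice of a least upper bound; antisymmetry leaves
  only one candidate.\<close>

lemma (in partial_order) join_eqI:
  assumes "least L s (Upper L {x, y})"
  shows "x \<squnion> y = s"
  unfolding join_def sup_def using assms least_unique by (intro some_equality) auto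

text \<open>The passage from an algebraic to an order-theoretic semilattice: idempotence yields
  reflexivity, commutativity antisymmetry, and associativity transitivity. It is applied to
  \<open>block_join\<close>.\<close>

lemma semilattice_operation_is_join:
  fixes J :: "'a \<Rightarrow> 'a \<Rightarrow> 'a"
  defines "L X \<equiv> \<lparr>carrier = X, eq = (=), le = (\<lambda>a b. J a b = b)\<rparr>"
  assumes closed: "\<And>a b. a \<in> X \<Longrightarrow> b \<in> X \<Longrightarrow> J a b \<in> X"
    and idem: "\<And>a. a \<in> X \<Longrightarrow> J a a = a"
    and comm: "\<And>a b. a \<in> X \<Longrightarrow> b \<in> X \<Longrightarrow> J a b = J b a"
    and assoc: "\<And>a b c. a \<in> X \<Longrightarrow> b \<in> X \<Longrightarrow> c \<in> X \<Longrightarrow> J (J a b) c = J a (J b c)"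
  shows "upper_semilattice (L X)"
    and "\<And>a b. a \<in> X \<Longrightarrow> b \<in> X \<Longrightarrow> a \<squnion>\<^bsub>L X\<^esub> b = J a b"
proof -
  interpret partial_order "L X"
  proof
    fix x y z assume "x \<sqsubseteq>\<^bsub>L X\<^esub> y" "y \<sqsubseteq>\<^bsub>L X\<^esub> z" "x \<in> carrier (L X)" "y \<in> carrier (L X)" "z \<in> carrier (L X)"
    \<comment> \<open>The chain is
      \<open>J x z = J x (J y z) = J (J x y) z = J y z = z\<close>.\<close>
    then show "x \<sqsubseteq>\<^bsub>L X\<^esub> z" by (simp add: L_def) (metis assoc)
  qed (use comm in \<open>auto simp: L_def idem\<close>)
  have least: "least (L X) (J a b) (Upper (L X) {a, b})" if ab: "a \<in> X" "b \<in> X" for a b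
  proof (rule least_UpperI)
    fix c assume "c \<in> {a, b}"
    moreover have "J a (J a b) = J a b" using assoc[of a a b] idem ab by simp
    moreover have "J b (J a b) = J a b"
      using assoc[of a b b] comm[of b "J a b"] idem closed ab by simp
    ultimately show "c \<sqsubseteq>\<^bsub>L X\<^esub> J a b" by (auto simp: L_def)
  next
    fix c assume "c \<in> Upper (L X) {a, b}"
    then have "c \<in> X" "J a c = c" "J b c = c" using ab by (auto simp: L_def Upper_def)
    then show "J a b \<sqsubseteq>\<^bsub>L X\<^esub> c" using assoc[of a b c] ab by (simp add: L_def)
  qed (use ab closed in \<open>auto simp: L_def\<close>)
  show "upper_semilattice (L X)"
    by unfold_locales (use least in \<open>auto simp: L_def\<close>)
  show "a \<squnion>\<^bsub>L X\<^esub> b = J a b" if "a \<in> X" "b \<in> X" for a b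
    using join_eqI[OF least[OF that]] .
qed

section \<open>The skeleton\<close>

lemma Sk_subset_carrier: "Sk M \<subseteq> carrier M"
  by (auto simp: Sk_def positive_def)

lemma tau_star_iff:
  "p \<in> tau_star M A B \<longleftrightarrow> (\<exists>x \<in> layer M A. \<exists>y \<in> layer M B.
     p = tau M (x \<cdot>\<^bsub>M\<^esub> y) \<or> p = tau M (x \<setminus>\<^bsub>M\<^esub> y) \<or> p = tau M (x \<sslash>\<^bsub>M\<^esub> y))"
  by (auto simp: tau_star_def)

lemma tau_star_mono:
  assumes "A \<subseteq> A'" "B \<subseteq> B'"
  shows "tau_star M A B \<subseteq> tau_star M A' B'"
  using assms unfolding tau_star_def layer_def by blast

section \<open>Monotonicity of multiplication\<close>

context residuated_posemigroup
begin

text \<open>Residuating \<open>y \<cdot> z \<sqsubseteq> y \<cdot> z\<close> gives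
  \<open>y \<sqsubseteq> (y \<cdot> z) \<sslash> z\<close>. This bound passes down to
  \<open>x\<close> and is residuated back.\<close>

lemma mul_right_mono:
  assumes "x \<in> carrier M" "y \<in> carrier M" "z \<in> carrier M" "x \<sqsubseteq> y"
  shows "x \<cdot> z \<sqsubseteq> y \<cdot> z"
  by (meson assms le_refl le_trans mul_closed residuation_right rres_closed)

lemma mul_left_mono:
  assumes "x \<in> carrier M" "y \<in> carrier M" "z \<in> carrier M" "x \<sqsubseteq> y"
  shows "z \<cdot> x \<sqsubseteq> z \<cdot> y"
  by (meson assms le_refl le_trans mul_closed residuation_left lres_closed)

lemma mul_mono:
  assumes "x \<in> carrier M" "y \<in> carrier M" "u \<in> carrier M" "v \<in> carrier M" "x \<sqsubseteq> y" "u \<sqsubseteq> v"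
  shows "x \<cdot> u \<sqsubseteq> y \<cdot> v"
  by (meson assms le_trans mul_closed mul_left_mono mul_right_mono)

end

context balanced_residuated_posemigroup
begin

lemma positiveD:
  assumes "positive M p" "z \<in> carrier M"
  shows "z \<sqsubseteq> z \<cdot> p" "z \<sqsubseteq> p \<cdot> z"
  using assms by (auto simp: positive_def)

text \<open>Positivity is the balance axiom and gives one half of idempotence. For the other half,
  \<open>x\<close> absorbs its residual once, hence twice, so the square of the residual lies below
  the residual.\<close>

lemma tau_in_Sk:
  assumes x: "x \<in> carrier M"
  shows "tau M x \<in> Sk M"
proof -
  let ?t = "x \<setminus> x"
  have t: "?t \<in> carrier M" using x by (simp add: lres_closed)
  have pos: "positive M ?t" using x by (rule balanced_positive)
  have xt: "x \<cdot> ?t \<sqsubseteq> x" using residuation_left[OF x t x] t by simp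
  have "x \<cdot> (?t \<cdot> ?t) = (x \<cdot> ?t) \<cdot> ?t" using x t by (simp add: mul_assoc)
  also have "\<dots> \<sqsubseteq> x \<cdot> ?t" using xt x t by (intro mul_right_mono) (auto simp: mul_closed)
  finally have "x \<cdot> (?t \<cdot> ?t) \<sqsubseteq> x"
    using xt by (rule le_trans) (use x t in \<open>auto simp: mul_closed\<close>)
  then have "?t \<cdot> ?t \<sqsubseteq> ?t" using x t by (simp add: residuation_left mul_closed)
  moreover have "?t \<sqsubseteq> ?t \<cdot> ?t" using positiveD(1)[OF pos t] .
  ultimately have "?t \<cdot> ?t = ?t" using t by (intro le_antisym) (auto simp: mul_closed)
  with pos show ?thesis by (simp add: tau_def Sk_def)
qed

text \<open>Idempotence gives \<open>u \<sqsubseteq> u \<setminus> u\<close>. Positivity gives the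
  converse through \<open>u \<setminus> u \<sqsubseteq> u \<cdot> (u \<setminus> u) \<sqsubseteq>
  u\<close>.\<close>

lemma tau_Sk:
  assumes "u \<in> Sk M"
  shows "tau M u = u"
proof -
  have u: "u \<in> carrier M" "positive M u" "u \<cdot> u = u"
    using assms by (auto simp: Sk_def positive_def)
  have t: "u \<setminus> u \<in> carrier M" using u by (simp add: lres_closed)
  have "u \<sqsubseteq> u \<setminus> u" using residuation_left[of u u u] u by simp
  moreover have "u \<cdot> (u \<setminus> u) \<sqsubseteq> u" using residuation_left[OF u(1) t u(1)] t by simp
  then have "u \<setminus> u \<sqsubseteq> u"
    using le_trans[OF positiveD(2)[OF u(2) t]] u t by (simp add: mul_closed)
  ultimately show ?thesis using u t by (auto simp: tau_def intro: le_antisym)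
qed

text \<open>Commutativity is not yet available to prove idempotence directly. Instead the product is
  shown to equal its own \<open>tau\<close>, which lies in the skeleton.\<close>

lemma Sk_mul_closed:
  assumes u: "u \<in> Sk M" and v: "v \<in> Sk M"
  shows "u \<cdot> v \<in> Sk M"
proof -
  have c: "u \<in> carrier M" "v \<in> carrier M" "u \<cdot> v \<in> carrier M"
    using u v Sk_subset_carrier[of M] by (blast intro: mul_closed)+
  have uu: "u \<cdot> u = u" and vv: "v \<cdot> v = v" and pu: "positive M u" and pv: "positive M v"
    using u v by (auto simp: Sk_def)
  define w where "w = (u \<cdot> v) \<setminus> (u \<cdot> v)"
  have w: "w \<in> Sk M" using tau_in_Sk[OF c(3)] by (simp add: w_def tau_def)
  have wc: "w \<in> carrier M" "w \<cdot> w = w" using w Sk_subset_carrier[of M] by (auto simp: Sk_def)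
  have "(u \<cdot> v) \<cdot> v = u \<cdot> v" using c vv by (simp add: mul_assoc)
  then have "v \<sqsubseteq> w" unfolding w_def using c residuation_left[of "u \<cdot> v" v "u \<cdot> v"] by simp
  moreover have "u \<cdot> (u \<cdot> v) = u \<cdot> v" using c uu mul_assoc[of u u v] by simp
  \<comment> \<open>The left residual detects absorption of the right factor \<open>v\<close>, the
    right residual that of the left factor \<open>u\<close>. Balance identifies the two residuals,
    so \<open>w\<close> bounds both factors.\<close>
  then have "u \<sqsubseteq> w" unfolding w_def balanced_eq[OF c(3)]
    using c residuation_right[of u "u \<cdot> v" "u \<cdot> v"] by simp
  ultimately have le: "u \<cdot> v \<sqsubseteq> w" using mul_mono[of u w v w] c wc by simp
  have pos: "positive M (u \<cdot> v)"
    unfolding positive_def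
  proof (intro conjI ballI)
    fix z assume z: "z \<in> carrier M"
    show "z \<sqsubseteq> z \<cdot> (u \<cdot> v)"
      using le_trans[OF positiveD(1)[OF pu z] positiveD(1)[OF pv, of "z \<cdot> u"]] z c
      by (simp add: mul_closed mul_assoc)
    show "z \<sqsubseteq> u \<cdot> v \<cdot> z"
      using le_trans[OF positiveD(2)[OF pv z] positiveD(2)[OF pu, of "v \<cdot> z"]] z c
      by (simp add: mul_closed mul_assoc)
  qed (use c in simp)
  have "(u \<cdot> v) \<cdot> w \<sqsubseteq> u \<cdot> v"
    using c wc(1) residuation_left[of "u \<cdot> v" w "u \<cdot> v"] by (simp add: w_def)
  then have "w \<sqsubseteq> u \<cdot> v"
    using le_trans[OF positiveD(2)[OF pos wc(1)]] c wc by (simp add: mul_closed)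
  with le have "u \<cdot> v = w" using c wc by (auto intro: le_antisym)
  with w show ?thesis by simp
qed

lemma partial_order_Sk: "partial_order (Sk_poset M)"
  by unfold_locales
    (use Sk_subset_carrier[of M] in \<open>auto simp: Sk_poset_def intro: le_antisym le_trans\<close>)

text \<open>Positivity of each factor puts the other below the product. An idempotent
  \<open>w\<close> above both satisfies
  \<open>u \<cdot> v \<sqsubseteq> w \<cdot> w = w\<close>.\<close>

lemma Sk_mul_least:
  assumes "u \<in> Sk M" "v \<in> Sk M"
  shows "least (Sk_poset M) (u \<cdot> v) (Upper (Sk_poset M) {u, v})"
proof -
  have c: "u \<in> carrier M" "v \<in> carrier M" "positive M u" "positive M v"
    using assms by (auto simp: Sk_def positive_def)
  show ?thesis
  proof (rule least_UpperI)
    fix x assume "x \<in> {u, v}"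
    then show "x \<sqsubseteq>\<^bsub>Sk_poset M\<^esub> u \<cdot> v"
      using c by (auto simp: Sk_poset_def positiveD)
  next
    fix w assume "w \<in> Upper (Sk_poset M) {u, v}"
    then have "w \<in> carrier M" "u \<sqsubseteq> w" "v \<sqsubseteq> w" "w \<cdot> w = w"
      using assms Sk_subset_carrier[of M] by (auto simp: Sk_poset_def Upper_def Sk_def)
    then show "u \<cdot> v \<sqsubseteq>\<^bsub>Sk_poset M\<^esub> w"
      using mul_mono[of u w v w] c by (simp add: Sk_poset_def)
  qed (use assms Sk_mul_closed in \<open>auto simp: Sk_poset_def\<close>)
qed

lemma Sk_join:
  assumes "u \<in> Sk M" "v \<in> Sk M"
  shows "u \<squnion>\<^bsub>Sk_poset M\<^esub> v = u \<cdot> v"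
  using partial_order.join_eqI[OF partial_order_Sk Sk_mul_least[OF assms]] .

text \<open>Commutativity comes from the order: both products are the join of the same two-element
  set.\<close>

lemma Sk_mul_commute:
  assumes "u \<in> Sk M" "v \<in> Sk M"
  shows "u \<cdot> v = v \<cdot> u"
  using Sk_join[OF assms] Sk_join[OF assms(2,1)] by (simp add: join_def insert_commute)

section \<open>Coherent partitions\<close>

lemma tau_star_subset_Sk: "tau_star M A B \<subseteq> Sk M"
  by (auto simp: tau_star_def layer_def mul_closed lres_closed rres_closed intro!: tau_in_Sk)

text \<open>Skeleton elements are fixed by \<open>tau\<close>, so they lie in the layers of their
  own blocks and their product is its own output. This links outputs to joins.\<close>

lemma mul_in_tau_star:
  assumes "u \<in> A" "v \<in> B" "u \<in> Sk M" "v \<in> Sk M"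
  shows "u \<cdot> v \<in> tau_star M A B"
proof -
  have "u \<in> layer M A" "v \<in> layer M B"
    using assms Sk_subset_carrier[of M] by (auto simp: layer_def tau_Sk)
  moreover have "tau M (u \<cdot> v) = u \<cdot> v" using assms by (intro tau_Sk Sk_mul_closed)
  ultimately show ?thesis unfolding tau_star_iff by metis
qed

lemma tau_star_nonempty:
  assumes "partition_on (Sk M) \<Theta>" "A \<in> \<Theta>" "B \<in> \<Theta>"
  shows "tau_star M A B \<noteq> {}"
proof -
  obtain u v where "u \<in> A" "v \<in> B" using assms by (metis all_not_in_conv partition_onD3)
  then show ?thesis using mul_in_tau_star[of u A v B] assms partition_onD1 by blast
qed

text \<open>The blocks cover all outputs, so a single output block contains every output.
  Conversely, disjointness allows at most one output block, and nonemptiness of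
  \<open>tau_star\<close> supplies one. Later arguments use the containment form.\<close>

lemma tau_residuation_coherent_iff:
  assumes P: "partition_on (Sk M) \<Theta>"
  shows "tau_residuation_coherent M \<Theta> \<longleftrightarrow> (\<forall>A \<in> \<Theta>. \<forall>B \<in> \<Theta>. \<exists>C \<in> \<Theta>. tau_star M A B \<subseteq> C)"
proof -
  have "is_singleton (Out M \<Theta> A B) \<longleftrightarrow> (\<exists>C \<in> \<Theta>. tau_star M A B \<subseteq> C)"
    if AB: "A \<in> \<Theta>" "B \<in> \<Theta>" for A B
  proof
    assume "is_singleton (Out M \<Theta> A B)"
    then obtain C where C: "Out M \<Theta> A B = {C}" by (auto simp: is_singleton_def)
    then have "C \<in> \<Theta>" by (auto simp: Out_def)
    moreover have "tau_star M A B \<subseteq> C"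
    proof
      fix p assume p: "p \<in> tau_star M A B"
      then obtain D where "D \<in> \<Theta>" "p \<in> D"
        using tau_star_subset_Sk partition_on_block_exists[OF P] by blast
      with p have "D \<in> Out M \<Theta> A B" by (auto simp: Out_def)
      with C \<open>p \<in> D\<close> show "p \<in> C" by simp
    qed
    ultimately show "\<exists>C \<in> \<Theta>. tau_star M A B \<subseteq> C" by blast
  next
    assume "\<exists>C \<in> \<Theta>. tau_star M A B \<subseteq> C"
    then obtain C where C: "C \<in> \<Theta>" "tau_star M A B \<subseteq> C" by blast
    then have "Out M \<Theta> A B = {C}"
      using tau_star_nonempty[OF P AB] partition_on_block_unique[OF P]
      unfolding Out_def by blast
    then show "is_singleton (Out M \<Theta> A B)" by simp
  qed
  then show ?thesis by (simp add: tau_residuation_coherent_def)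
qed

lemma coherent_imp_multiplication_coherent:
  assumes "partition_on (Sk M) \<Theta>" "tau_residuation_coherent M \<Theta>"
  shows "tau_multiplication_coherent M \<Theta>"
  unfolding tau_multiplication_coherent_def
proof (intro ballI)
  fix A B assume "A \<in> \<Theta>" "B \<in> \<Theta>"
  then obtain C where "C \<in> \<Theta>" "tau_star M A B \<subseteq> C"
    using assms tau_residuation_coherent_iff by blast
  moreover have "{tau M (x \<cdot> y) | x y. x \<in> layer M A \<and> y \<in> layer M B} \<subseteq> tau_star M A B"
    unfolding tau_star_def by blast
  ultimately show "\<exists>C \<in> \<Theta>. {tau M (x \<cdot> y) | x y. x \<in> layer M A \<and> y \<in> layer M B} \<subseteq> C"
    by blast
qed

section \<open>The join-semilattice of blocks\<close>

lemma coherent_block_join: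
  assumes P: "partition_on (Sk M) \<Theta>" and coh: "tau_residuation_coherent M \<Theta>"
    and AB: "A \<in> \<Theta>" "B \<in> \<Theta>" "u \<in> A" "v \<in> B"
  shows "block_join M \<Theta> A B \<in> \<Theta>" "u \<cdot> v \<in> block_join M \<Theta> A B"
    "block_join M \<Theta> A B = block \<Theta> (u \<squnion>\<^bsub>Sk_poset M\<^esub> v)"
proof -
  obtain C where C: "C \<in> \<Theta>" "tau_star M A B \<subseteq> C"
    using AB P coh tau_residuation_coherent_iff by blast
  have Sk: "x \<in> Sk M" "y \<in> Sk M" if "x \<in> A" "y \<in> B" for x y
    using that AB P partition_onD1 by blast+
  have inC: "x \<cdot> y \<in> C" if "x \<in> A" "y \<in> B" for x y
    using C(2) mul_in_tau_star[OF that Sk[OF that]] by blast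
  have blk: "block \<Theta> (x \<squnion>\<^bsub>Sk_poset M\<^esub> y) = C" if "x \<in> A" "y \<in> B" for x y
    using block_eq[OF P C(1) inC[OF that]] Sk_join[OF Sk[OF that]] by simp
  \<comment> \<open>All joins of representatives are products in \<open>C\<close>, so the
    description has a unique value; the given \<open>u\<close> and \<open>v\<close> witness that it
    has one at all.\<close>
  have "block_join M \<Theta> A B = C"
    unfolding block_join_def using blk AB by (intro the_equality) auto
  then show "block_join M \<Theta> A B \<in> \<Theta>" "u \<cdot> v \<in> block_join M \<Theta> A B"
    "block_join M \<Theta> A B = block \<Theta> (u \<squnion>\<^bsub>Sk_poset M\<^esub> v)"
    using C inC blk AB by auto
qed

text \<open>For each law, both sides contain the same product of representatives, by the
  corresponding law in the skeleton. Blocks sharing a point are equal.\<close>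

lemma coherent_block_semilattice:
  assumes P: "partition_on (Sk M) \<Theta>" and coh: "tau_residuation_coherent M \<Theta>"
  shows "upper_semilattice (block_poset M \<Theta>)"
    and "\<And>A B. A \<in> \<Theta> \<Longrightarrow> B \<in> \<Theta> \<Longrightarrow> A \<squnion>\<^bsub>block_poset M \<Theta>\<^esub> B = block_join M \<Theta> A B"
proof -
  let ?J = "block_join M \<Theta>"
  note J = coherent_block_join[OF P coh]
  have rep: "\<exists>u \<in> A. u \<in> Sk M" if "A \<in> \<Theta>" for A
    using that P unfolding partition_on_def by (metis UnionI all_not_in_conv)
  have closed: "?J A B \<in> \<Theta>" if "A \<in> \<Theta>" "B \<in> \<Theta>" for A B
    using J(1) rep that by meson
  have idem: "?J A A = A" if A: "A \<in> \<Theta>" for A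
  proof -
    obtain u where u: "u \<in> A" "u \<in> Sk M" using rep[OF A] by blast
    have "u \<in> ?J A A" using J(2)[OF A A u(1) u(1)] u(2) by (simp add: Sk_def)
    then show ?thesis using partition_on_block_unique[OF P closed[OF A A] A] u by blast
  qed
  have comm: "?J A B = ?J B A" if AB: "A \<in> \<Theta>" "B \<in> \<Theta>" for A B
  proof -
    obtain u v where uv: "u \<in> A" "u \<in> Sk M" "v \<in> B" "v \<in> Sk M" using rep AB by blast
    have "u \<cdot> v \<in> ?J A B" "u \<cdot> v \<in> ?J B A"
      using J(2)[OF AB uv(1,3)] J(2)[OF AB(2,1) uv(3,1)] Sk_mul_commute uv by simp_all
    then show ?thesis using partition_on_block_unique[OF P] closed AB by blast
  qed
  have assoc: "?J (?J A B) C = ?J A (?J B C)" if ABC: "A \<in> \<Theta>" "B \<in> \<Theta>" "C \<in> \<Theta>" for A B C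
  proof -
    obtain u v w where uvw: "u \<in> A" "u \<in> Sk M" "v \<in> B" "v \<in> Sk M" "w \<in> C" "w \<in> Sk M"
      using rep ABC by metis
    have c: "u \<in> carrier M" "v \<in> carrier M" "w \<in> carrier M" using uvw Sk_subset_carrier[of M] by auto
    have "u \<cdot> v \<cdot> w \<in> ?J (?J A B) C"
      using J(2)[OF closed ABC(3) J(2) uvw(5)] ABC uvw by simp
    moreover have "u \<cdot> (v \<cdot> w) \<in> ?J A (?J B C)"
      using J(2)[OF ABC(1) closed uvw(1) J(2)] ABC uvw by simp
    ultimately show ?thesis
      using partition_on_block_unique[OF P] closed ABC mul_assoc c by metis
  qed
  show "upper_semilattice (block_poset M \<Theta>)"
    unfolding block_poset_def
    using semilattice_operation_is_join(1)[of \<Theta> ?J] closed idem comm assoc by blast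
  show "A \<squnion>\<^bsub>block_poset M \<Theta>\<^esub> B = ?J A B" if "A \<in> \<Theta>" "B \<in> \<Theta>" for A B
    unfolding block_poset_def
    using semilattice_operation_is_join(2)[of \<Theta> ?J A B] closed idem comm assoc that by blast
qed

section \<open>The coherentization\<close>

lemma out_edges_sym: "sym (out_edges M \<Theta>)"
  unfolding out_edges_def sym_def by blast

lemma out_edges_subset: "out_edges M \<Theta> \<subseteq> \<Theta> \<times> \<Theta>"
  unfolding out_edges_def Out_def by blast

lemma partition_on_CC_r:
  assumes "partition_on (Sk M) \<Theta>"
  shows "partition_on (Sk M) (CC_r M \<Theta>)"
  unfolding CC_r_def using partition_on_merge[OF assms out_edges_sym out_edges_subset] .

lemma partition_on_coherentization_step: "partition_on (Sk M) (coherentization_step M n)"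
proof (induction n)
  case 0
  then show ?case using partition_on_singletons[of "Sk M"] by (simp add: setcompr_eq_image)
next
  case (Suc n)
  then show ?case by (simp add: partition_on_CC_r)
qed

text \<open>Every block belongs to its own component, by the empty path.\<close>

lemma partition_rel_CC_r_mono: "partition_rel \<Theta> \<subseteq> partition_rel (CC_r M \<Theta>)"
proof
  fix p assume "p \<in> partition_rel \<Theta>"
  then obtain u v C where "p = (u, v)" "C \<in> \<Theta>" "u \<in> C" "v \<in> C"
    by (auto simp: partition_rel_def)
  moreover from this have "u \<in> \<Union> ((out_edges M \<Theta>)\<^sup>* `` {C})" "v \<in> \<Union> ((out_edges M \<Theta>)\<^sup>* `` {C})"
    by blast+
  ultimately show "p \<in> partition_rel (CC_r M \<Theta>)"
    unfolding partition_rel_def CC_r_def by blast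
qed

lemma mono_step: "mono (\<lambda>n. partition_rel (coherentization_step M n))"
  by (rule mono_iff_le_Suc[THEN iffD2]) (simp add: partition_rel_CC_r_mono)

text \<open>One application of \<open>CC_r\<close> repairs every coherence failure of
  \<open>\<Theta>\<close> itself. It may create new ones for the larger blocks, hence the
  iteration.\<close>

lemma tau_star_CC_r:
  assumes P: "partition_on (Sk M) \<Theta>" and AB: "A \<in> \<Theta>" "B \<in> \<Theta>"
    and pq: "p \<in> tau_star M A B" "q \<in> tau_star M A B"
  shows "(p, q) \<in> partition_rel (CC_r M \<Theta>)"
proof -
  obtain C D where C: "C \<in> \<Theta>" "p \<in> C" and D: "D \<in> \<Theta>" "q \<in> D"
    using pq tau_star_subset_Sk partition_on_block_exists[OF P] by (metis subsetD)
  then have "C \<in> Out M \<Theta> A B" "D \<in> Out M \<Theta> A B" using pq by (auto simp: Out_def)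
  \<comment> \<open>Edges join distinct blocks only, so equal blocks are handled by
    reflexivity.\<close>
  then have "(C, D) \<in> (out_edges M \<Theta>)\<^sup>*"
    using AB by (cases "C = D") (auto simp: out_edges_def intro!: r_into_rtrancl)
  then have "p \<in> \<Union> ((out_edges M \<Theta>)\<^sup>* `` {C})" "q \<in> \<Union> ((out_edges M \<Theta>)\<^sup>* `` {C})"
    using C D by auto
  then show ?thesis using C unfolding partition_rel_def CC_r_def by blast
qed

section \<open>Coherence of the limit\<close>

lemma equiv_limit: "equiv (Sk M) (\<Union>n. partition_rel (coherentization_step M n))"
  by (rule equiv_UN_mono[OF equiv_partition_rel[OF partition_on_coherentization_step] mono_step])

lemma partition_on_residual_coherentization: "partition_on (Sk M) (residual_coherentization M)"
  unfolding residual_coherentization_def by (rule partition_on_quotient[OF equiv_limit])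

lemma coherent_residual_coherentization:
  "tau_residuation_coherent M (residual_coherentization M)"
  unfolding tau_residuation_coherent_iff[OF partition_on_residual_coherentization]
proof (intro ballI)
  fix A B assume A: "A \<in> residual_coherentization M" and B: "B \<in> residual_coherentization M"
  define r where "r n = partition_rel (coherentization_step M n)" for n
  have eq: "equiv (Sk M) (\<Union>n. r n)" unfolding r_def by (rule equiv_limit)
  have AB: "A \<in> Sk M // (\<Union>n. r n)" "B \<in> Sk M // (\<Union>n. r n)"
    using A B by (simp_all add: residual_coherentization_def r_def)
  have rel: "(p, q) \<in> (\<Union>n. r n)" if pq: "p \<in> tau_star M A B" "q \<in> tau_star M A B" for p q
  proof -
    obtain x y where xy: "x \<in> layer M A" "y \<in> layer M B"
        "p = tau M (x \<cdot> y) \<or> p = tau M (x \<setminus> y) \<or> p = tau M (x \<sslash> y)"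
      using pq(1) unfolding tau_star_iff by blast
    obtain x' y' where xy': "x' \<in> layer M A" "y' \<in> layer M B"
        "q = tau M (x' \<cdot> y') \<or> q = tau M (x' \<setminus> y') \<or> q = tau M (x' \<sslash> y')"
      using pq(2) unfolding tau_star_iff by blast
    have "(tau M x, tau M x') \<in> (\<Union>n. r n)" "(tau M y, tau M y') \<in> (\<Union>n. r n)"
      using quotient_eq_iff[OF eq AB(1) AB(1)] quotient_eq_iff[OF eq AB(2) AB(2)] xy(1,2) xy'(1,2)
      unfolding layer_def by blast+
    then obtain i j where "(tau M x, tau M x') \<in> r i" "(tau M y, tau M y') \<in> r j" by blast
    \<comment> \<open>The two identifications may appear at different stages. A common stage is
      needed so that \<open>p\<close> and \<open>q\<close> become outputs of one pair of
      blocks.\<close>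
    then have "(tau M x, tau M x') \<in> r (max i j)" "(tau M y, tau M y') \<in> r (max i j)"
      using monoD[OF mono_step] unfolding r_def by (meson max.cobounded1 max.cobounded2 subsetD)+
    then obtain A' B' where A': "A' \<in> coherentization_step M (max i j)" "tau M x \<in> A'" "tau M x' \<in> A'"
      and B': "B' \<in> coherentization_step M (max i j)" "tau M y \<in> B'" "tau M y' \<in> B'"
      unfolding r_def partition_rel_def by blast
    have "x \<in> layer M A'" "x' \<in> layer M A'" "y \<in> layer M B'" "y' \<in> layer M B'"
      using A' B' xy xy' by (auto simp: layer_def)
    then have "p \<in> tau_star M A' B'" "q \<in> tau_star M A' B'"
      using xy(3) xy'(3) unfolding tau_star_iff by blast+
    then have "(p, q) \<in> r (Suc (max i j))"
      unfolding r_def coherentization_step.simps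
      by (rule tau_star_CC_r[OF partition_on_coherentization_step A'(1) B'(1)])
    then show ?thesis by blast
  qed
  \<comment> \<open>The required block is the limit class of any one output; \<open>rel\<close>
    places all the others in it.\<close>
  obtain p where p: "p \<in> tau_star M A B"
    using tau_star_nonempty[OF partition_on_residual_coherentization A B] by blast
  then have "p \<in> Sk M" using tau_star_subset_Sk by blast
  then have "(\<Union>n. r n) `` {p} \<in> residual_coherentization M"
    unfolding residual_coherentization_def r_def by (rule quotientI)
  moreover have "tau_star M A B \<subseteq> (\<Union>n. r n) `` {p}" using rel[OF p] by blast
  ultimately show "\<exists>C \<in> residual_coherentization M. tau_star M A B \<subseteq> C" by blast
qed

section \<open>Minimality among coherent partitions\<close>

lemma CC_r_refines_coherent:
  assumes P: "partition_on (Sk M) \<Phi>" and coh: "tau_residuation_coherent M \<Phi>"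
    and ref: "refines (Sk M) \<Theta> \<Phi>"
  shows "refines (Sk M) (CC_r M \<Theta>) \<Phi>"
proof -
  have part: "partition_on (Sk M) \<Theta>" and sub: "\<And>A. A \<in> \<Theta> \<Longrightarrow> \<exists>F \<in> \<Phi>. A \<subseteq> F"
    using ref by (auto simp: refines_def)
  \<comment> \<open>Both ends of an edge meet the single \<open>\<Phi>\<close>-block
    \<open>E\<close> of outputs of the enclosing blocks, and each end lies inside one
    \<open>\<Phi>\<close>-block, so both lie in \<open>E\<close>. Stated as propagation from
    \<open>C\<close> to \<open>D\<close>, this is the induction step along paths.\<close>
  have edge: "D \<subseteq> F" if CD: "(C, D) \<in> out_edges M \<Theta>" and F: "F \<in> \<Phi>" "C \<subseteq> F" for C D F
  proof -
    obtain A B where AB: "A \<in> \<Theta>" "B \<in> \<Theta>" "C \<in> Out M \<Theta> A B" "D \<in> Out M \<Theta> A B"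
      using CD by (auto simp: out_edges_def)
    obtain A' B' where A'B': "A' \<in> \<Phi>" "B' \<in> \<Phi>" "A \<subseteq> A'" "B \<subseteq> B'" using sub AB by meson
    obtain E where E: "E \<in> \<Phi>" "tau_star M A' B' \<subseteq> E"
      using A'B' coh tau_residuation_coherent_iff[OF P] by blast
    then have "tau_star M A B \<subseteq> E" using tau_star_mono[OF A'B'(3,4)] by blast
    then have "C \<inter> E \<noteq> {}" "D \<inter> E \<noteq> {}" "D \<in> \<Theta>" using AB by (auto simp: Out_def)
    moreover obtain G where "G \<in> \<Phi>" "D \<subseteq> G" using sub \<open>D \<in> \<Theta>\<close> by blast
    moreover have "F = E" using \<open>C \<inter> E \<noteq> {}\<close> F E partition_on_block_unique[OF P] by blast
    moreover have "G = E"
      using \<open>D \<inter> E \<noteq> {}\<close> \<open>G \<in> \<Phi>\<close> \<open>D \<subseteq> G\<close> E partition_on_block_unique[OF P] by blast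
    ultimately show ?thesis by simp
  qed
  have "\<exists>F \<in> \<Phi>. X \<subseteq> F" if "X \<in> CC_r M \<Theta>" for X
  proof -
    obtain C where C: "C \<in> \<Theta>" "X = \<Union> ((out_edges M \<Theta>)\<^sup>* `` {C})"
      using \<open>X \<in> CC_r M \<Theta>\<close> by (auto simp: CC_r_def)
    obtain F where F: "F \<in> \<Phi>" "C \<subseteq> F" using sub C by blast
    have "D \<subseteq> F" if "(C, D) \<in> (out_edges M \<Theta>)\<^sup>*" for D
      using that by (induction rule: rtrancl_induct) (use F edge in blast)+
    with C F show ?thesis by blast
  qed
  then show ?thesis using P partition_on_CC_r[OF part] by (simp add: refines_def)
qed

lemma residual_coherentization_refines:
  assumes P: "partition_on (Sk M) \<Phi>" and coh: "tau_residuation_coherent M \<Phi>"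
  shows "refines (Sk M) (residual_coherentization M) \<Phi>"
proof -
  have step: "refines (Sk M) (coherentization_step M n) \<Phi>" for n
  proof (induction n)
    case 0
    have "\<exists>F \<in> \<Phi>. {u} \<subseteq> F" if "u \<in> Sk M" for u
      using partition_on_block_exists[OF P that] by blast
    then show ?case
      using P partition_on_coherentization_step[of 0] by (auto simp: refines_def)
  next
    case (Suc n)
    then show ?case using CC_r_refines_coherent[OF P coh] by simp
  qed
  have "\<exists>F \<in> \<Phi>. A \<subseteq> F" if A: "A \<in> residual_coherentization M" for A
  proof -
    obtain u where u: "u \<in> Sk M"
        "A = (\<Union>n. partition_rel (coherentization_step M n)) `` {u}"
      using A unfolding residual_coherentization_def by (rule quotientE)
    obtain F where F: "F \<in> \<Phi>" "u \<in> F" using partition_on_block_exists[OF P u(1)] by blast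
    \<comment> \<open>The stage depends on \<open>v\<close>, but the \<open>\<Phi>\<close>-block
      reached there always contains \<open>u\<close> and is therefore the fixed
      \<open>F\<close>.\<close>
    have "v \<in> F" if v: "v \<in> A" for v
    proof -
      obtain n B where "B \<in> coherentization_step M n" "u \<in> B" "v \<in> B"
        using v unfolding u(2) partition_rel_def by blast
      moreover from this obtain G where "G \<in> \<Phi>" "B \<subseteq> G" using step[of n] by (auto simp: refines_def)
      ultimately show ?thesis using F partition_on_block_unique[OF P] by blast
    qed
    with F show ?thesis by blast
  qed
  then show ?thesis using P partition_on_residual_coherentization by (simp add: refines_def)
qed

end

text \<open>Since \<open>block_join\<close> is a definite description, the equation for arbitrary
  representatives is what expresses its well-definedness. The equation after
  \<open>upper_semilattice\<close> identifies the order-theoretic join with that operation.\<close>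

theorem theorem4p14:
  fixes M :: "('a, 'm) residuated_struct_scheme"
    and \<C> :: "'a set set"
  assumes "balanced_residuated_posemigroup M"
    and "\<C> = residual_coherentization M"
  shows "partition_on (Sk M) \<C> \<and>
         tau_residuation_coherent M \<C> \<and>
         (\<forall>\<Phi>. partition_on (Sk M) \<Phi> \<and> tau_residuation_coherent M \<Phi> \<longrightarrow> refines (Sk M) \<C> \<Phi>) \<and>
         (\<forall>A \<in> \<C>. \<forall>B \<in> \<C>. \<forall>u \<in> A. \<forall>v \<in> B.
            block_join M \<C> A B = block \<C> (u \<squnion>\<^bsub>Sk_poset M\<^esub> v)) \<and>
         upper_semilattice (block_poset M \<C>) \<and>
         (\<forall>A \<in> \<C>. \<forall>B \<in> \<C>. A \<squnion>\<^bsub>block_poset M \<C>\<^esub> B = block_join M \<C> A B) \<and>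
         tau_multiplication_coherent M \<C>"
proof -
  interpret balanced_residuated_posemigroup M by (rule assms(1))
  note part = partition_on_residual_coherentization
  note coh = coherent_residual_coherentization
  show ?thesis
    unfolding assms(2)
    using part coh residual_coherentization_refines coherent_block_join(3)[OF part coh]
      coherent_block_semilattice[OF part coh] coherent_imp_multiplication_coherent[OF part coh]
    by (intro conjI allI impI ballI) blast+
qed

end
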